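(* Let $n\ge 2$. For any normal matrix $A\in\mathbb{M}(n)$, $$\mathrm{spd}(A)\ge\frac{n}{n-1}\left\|A-\frac{\operatorname{tr}A}{n}I\right\|.$$
   Context: $\mathbb{M}(n)$ is the algebra of all $n\times n$ complex matrices, and $\|\cdot\|$ denotes the spectral (operator) norm. The spread of $A\in\mathbb{M}(n)$ with eigenvalues $\lambda_1(A),\dots,\lambda_n(A)$ is $\mathrm{spd}(A)=\max_{1\le i,j\le n}|\lambda_i(A)-\lambda_j(A)|$. *)

theory Defs
  imports
    "Jordan_Normal_Form.Schur_Decomposition"
    "Jordan_Normal_Form.Spectral_Radius"
    "HOL-Analysis.L2_Norm"
begin

definition mat_trace :: "'a :: comm_monoid_add mat \<Rightarrow> 'a" where
  "mat_trace A = (\<Sum>i<dim_row A. A $$ (i, i))"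

definition normal_mat :: "complex mat \<Rightarrow> bool" where
  "normal_mat A \<longleftrightarrow> square_mat A \<and> A * mat_adjoint A = mat_adjoint A * A"

definition euclid_norm :: "complex vec \<Rightarrow> real" where
  "euclid_norm v = L2_set (\<lambda>i. cmod (v $ i)) {..<dim_vec v}"

text \<open>The operator norm induced by the Euclidean norm. The set below is bounded above, and
  nonempty when \<open>A\<close> has at least one column; without columns the value is unspecified.\<close>

definition spectral_norm :: "complex mat \<Rightarrow> real" where
  "spectral_norm A =
     Sup {euclid_norm (A *\<^sub>v v) | v. v \<in> carrier_vec (dim_col A) \<and> euclid_norm v = 1}"

text \<open>Listing eigenvalues with or without multiplicity gives the same set of differences, so the
  maximum ranges over \<^const>\<open>spectrum\<close>, which is finite and nonempty for a complex square
  matrix of positive size.\<close>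

definition spread :: "complex mat \<Rightarrow> real" where
  "spread A = Max {cmod (x - y) | x y. x \<in> spectrum A \<and> y \<in> spectrum A}"

end

theory Submission
  imports Defs
begin

text \<open>The trace is the sum of the eigenvalues, so every eigenvalue \<open>l\<close> satisfies
  \<open>n (l - tr A / n) = (\<Sum>j. l - l\<^sub>j)\<close>, where one of the \<open>n\<close> summands vanishes and the others have
  modulus at most the spread. It remains to see that the norm of a normal matrix \<open>B\<close> is at most
  its spectral radius. Instead of unitary diagonalisation this uses
  \<open>\<parallel>B v\<parallel>\<^sup>k \<le> \<parallel>B\<^sup>k v\<parallel>\<close> for unit vectors \<open>v\<close>: if the spectral radius is below \<open>1\<close>, the powers
  of \<open>B\<close> are bounded by the Jordan normal form, hence \<open>\<parallel>B v\<parallel> \<le> 1\<close>, and the general case follows by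
  scaling.\<close>

section \<open>Euclidean norm and Hermitian inner product\<close>

lemma L2_set_power2: "(L2_set f A)\<^sup>2 = (\<Sum>i\<in>A. (f i)\<^sup>2)"
  unfolding L2_set_def by (simp add: sum_nonneg)

lemma euclid_norm_nonneg [simp]: "0 \<le> euclid_norm v"
  unfolding euclid_norm_def by simp

lemma cscalar_prod_self: "v \<bullet>c v = complex_of_real ((euclid_norm v)\<^sup>2)"
  unfolding euclid_norm_def L2_set_power2 scalar_prod_def
  by (simp add: atLeast0LessThan complex_norm_square flip: of_real_power)

lemma cmod_cscalar_prod_le:
  assumes "u \<in> carrier_vec n" "v \<in> carrier_vec n"
  shows "cmod (u \<bullet>c v) \<le> euclid_norm u * euclid_norm v"
proof -
  have "cmod (u \<bullet>c v) \<le> (\<Sum>i<n. \<bar>cmod (u $ i)\<bar> * \<bar>cmod (v $ i)\<bar>)"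
    unfolding scalar_prod_def using assms
    by (auto simp: atLeast0LessThan norm_mult intro!: order_trans[OF norm_sum] sum_mono)
  also have "\<dots> \<le> euclid_norm u * euclid_norm v"
    using L2_set_mult_ineq[of "\<lambda>i. cmod (u $ i)" "\<lambda>i. cmod (v $ i)" "{..<n}"] assms
    unfolding euclid_norm_def by simp
  finally show ?thesis .
qed

lemma euclid_norm_smult: "euclid_norm (c \<cdot>\<^sub>v v) = cmod c * euclid_norm v"
  unfolding euclid_norm_def
  by (subst L2_set_right_distrib) (auto simp: norm_mult intro: L2_set_cong)

section \<open>Adjoint matrices\<close>

lemma mat_adjoint_dim [simp]:
  "dim_row (mat_adjoint A) = dim_col A" "dim_col (mat_adjoint A) = dim_row A"
  unfolding mat_adjoint_def by auto

lemma mat_adjoint_carrier [simp]: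
  "A \<in> carrier_mat n m \<Longrightarrow> mat_adjoint A \<in> carrier_mat m n"
  by (intro carrier_matI) auto

lemma mat_adjoint_index:
  "i < dim_col A \<Longrightarrow> j < dim_row A \<Longrightarrow> mat_adjoint A $$ (i, j) = conjugate (A $$ (j, i))"
  unfolding mat_adjoint_def by (simp add: mat_of_rows_def)

lemma mat_adjoint_smult: "mat_adjoint (c \<cdot>\<^sub>m A) = conjugate c \<cdot>\<^sub>m mat_adjoint (A :: complex mat)"
  by (rule eq_matI) (auto simp: mat_adjoint_index)

lemma mat_adjoint_add:
  assumes "A \<in> carrier_mat n m" "B \<in> carrier_mat n m"
  shows "mat_adjoint (A + B) = mat_adjoint A + mat_adjoint (B :: complex mat)"
  using assms by (intro eq_matI) (auto simp: mat_adjoint_index)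

lemma mat_adjoint_one: "mat_adjoint (1\<^sub>m n) = (1\<^sub>m n :: complex mat)"
  by (rule eq_matI) (auto simp: mat_adjoint_index)

lemma cscalar_prod_mat_adjoint:
  fixes A :: "complex mat"
  assumes A: "A \<in> carrier_mat n m" and u: "u \<in> carrier_vec m" and v: "v \<in> carrier_vec n"
  shows "(A *\<^sub>v u) \<bullet>c v = u \<bullet>c (mat_adjoint A *\<^sub>v v)"
proof -
  have "(A *\<^sub>v u) \<bullet>c v = (\<Sum>i<n. \<Sum>j<m. A $$ (i, j) * u $ j * cnj (v $ i))"
    using assms by (auto simp: scalar_prod_def atLeast0LessThan sum_distrib_right)
  also have "\<dots> = (\<Sum>j<m. \<Sum>i<n. A $$ (i, j) * u $ j * cnj (v $ i))"
    by (rule sum.swap)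
  also have "\<dots> = u \<bullet>c (mat_adjoint A *\<^sub>v v)"
    using assms
    by (auto simp: scalar_prod_def atLeast0LessThan sum_distrib_left mat_adjoint_index mult_ac
        intro!: sum.cong)
  finally show ?thesis .
qed

lemma smult_mult_mat_vec:
  fixes A :: "'a :: comm_semiring_0 mat"
  assumes "A \<in> carrier_mat n m" "v \<in> carrier_vec m"
  shows "(c \<cdot>\<^sub>m A) *\<^sub>v v = c \<cdot>\<^sub>v (A *\<^sub>v v)"
  using assms by (intro eq_vecI) (auto simp: scalar_prod_def sum_distrib_left mult.assoc)

section \<open>Normality under scaling and shifting\<close>

lemma normal_mat_smult:
  assumes "normal_mat A"
  shows "normal_mat (c \<cdot>\<^sub>m A)"
proof -
  define n where "n = dim_row A"
  have A: "A \<in> carrier_mat n n" and AA: "A * mat_adjoint A = mat_adjoint A * A"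
    using assms unfolding normal_mat_def n_def by auto
  note A' = mat_adjoint_carrier[OF A]
  show ?thesis
    unfolding normal_mat_def mat_adjoint_smult
    using A A' AA
    by (auto simp: mult_smult_distrib[of _ n n _ n] mult_smult_assoc_mat[of _ n n _ n] mult.commute)
qed

text \<open>Scalar matrices commute with \<open>A\<close> and with its adjoint, so the two products
  expand to the same terms up to order, once \<open>A\<close> itself commutes with its
  adjoint.\<close>

lemma normal_mat_add_smult_one:
  assumes A: "A \<in> carrier_mat n n" and normal: "normal_mat A"
  shows "normal_mat (A + d \<cdot>\<^sub>m 1\<^sub>m n)"
proof -
  have AA: "A * mat_adjoint A = mat_adjoint A * A"
    using normal unfolding normal_mat_def by auto
  note A' = mat_adjoint_carrier[OF A]
  have adj: "mat_adjoint (A + d \<cdot>\<^sub>m 1\<^sub>m n) = mat_adjoint A + cnj d \<cdot>\<^sub>m 1\<^sub>m n"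
    using A by (simp add: mat_adjoint_add[of _ n n] mat_adjoint_smult mat_adjoint_one)
  have L: "(A + d \<cdot>\<^sub>m 1\<^sub>m n) * (mat_adjoint A + cnj d \<cdot>\<^sub>m 1\<^sub>m n)
      = A * mat_adjoint A + cnj d \<cdot>\<^sub>m A + (d \<cdot>\<^sub>m mat_adjoint A + (d * cnj d) \<cdot>\<^sub>m 1\<^sub>m n)"
    using A A' by (simp add: add_mult_distrib_mat[of _ n n _ _ n] mult_add_distrib_mat[of _ n n _ n]
        mult_smult_distrib[of _ n n _ n] mult_smult_assoc_mat[of _ n n _ n])
      (intro eq_matI, auto simp: algebra_simps)
  have R: "(mat_adjoint A + cnj d \<cdot>\<^sub>m 1\<^sub>m n) * (A + d \<cdot>\<^sub>m 1\<^sub>m n)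
      = mat_adjoint A * A + d \<cdot>\<^sub>m mat_adjoint A + (cnj d \<cdot>\<^sub>m A + (d * cnj d) \<cdot>\<^sub>m 1\<^sub>m n)"
    using A A' by (simp add: add_mult_distrib_mat[of _ n n _ _ n] mult_add_distrib_mat[of _ n n _ n]
        mult_smult_distrib[of _ n n _ n] mult_smult_assoc_mat[of _ n n _ n])
      (intro eq_matI, auto simp: algebra_simps)
  show ?thesis
    unfolding normal_mat_def adj L R AA using A A'
    by (auto intro!: eq_matI)
qed

section \<open>Norm inequalities for normal matrices\<close>

lemma normal_mat_norm_adjoint:
  assumes A: "A \<in> carrier_mat n n" and normal: "normal_mat A" and v: "v \<in> carrier_vec n"
  shows "euclid_norm (mat_adjoint A *\<^sub>v v) = euclid_norm (A *\<^sub>v v)"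
proof -
  note A' = mat_adjoint_carrier[OF A]
  have AA: "A * mat_adjoint A = mat_adjoint A * A"
    using normal unfolding normal_mat_def by auto
  have "(A *\<^sub>v v) \<bullet>c (A *\<^sub>v v) = v \<bullet>c ((mat_adjoint A * A) *\<^sub>v v)"
    using A v by (simp add: cscalar_prod_mat_adjoint[of _ n n] assoc_mult_mat_vec[OF A' A v])
  \<comment> \<open>The adjoint law moves a matrix out of the left argument only; conjugate symmetry
    brings \<open>A\<close> there.\<close>
  also have "\<dots> = v \<bullet>c (A *\<^sub>v (mat_adjoint A *\<^sub>v v))"
    unfolding AA[symmetric] by (simp add: assoc_mult_mat_vec[OF A A' v])
  also have "\<dots> = conjugate ((A *\<^sub>v (mat_adjoint A *\<^sub>v v)) \<bullet>c v)"
    using A A' v by (metis conjugate_conjugate_sprod conjugate_vec_sprod_comm mult_mat_vec_carrier)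
  also have "\<dots> = conjugate ((mat_adjoint A *\<^sub>v v) \<bullet>c (mat_adjoint A *\<^sub>v v))"
    using cscalar_prod_mat_adjoint[OF A mult_mat_vec_carrier[OF A' v] v] by simp
  finally have "(euclid_norm (A *\<^sub>v v))\<^sup>2 = (euclid_norm (mat_adjoint A *\<^sub>v v))\<^sup>2"
    unfolding cscalar_prod_self conjugate_complex_def complex_cnj_complex_of_real of_real_eq_iff .
  then show ?thesis by simp
qed

text \<open>Cauchy-Schwarz after one factor \<open>A\<close> has moved to the other side as an
  adjoint; at the vector \<open>A *\<^sub>v v\<close> normality lets \<open>A\<close> replace that
  adjoint inside the norm.\<close>

lemma normal_mat_norm_square_le:
  assumes A: "A \<in> carrier_mat n n" and normal: "normal_mat A" and v: "v \<in> carrier_vec n"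
  shows "(euclid_norm (A *\<^sub>v v))\<^sup>2 \<le> euclid_norm (A *\<^sub>v (A *\<^sub>v v)) * euclid_norm v"
proof -
  note A' = mat_adjoint_carrier[OF A]
  have Av: "A *\<^sub>v v \<in> carrier_vec n" using A v by simp
  have "(euclid_norm (A *\<^sub>v v))\<^sup>2 = cmod ((A *\<^sub>v v) \<bullet>c (A *\<^sub>v v))"
    unfolding cscalar_prod_self norm_of_real by simp
  also have "\<dots> = cmod (v \<bullet>c (mat_adjoint A *\<^sub>v (A *\<^sub>v v)))"
    using cscalar_prod_mat_adjoint[OF A v Av] by simp
  also have "\<dots> \<le> euclid_norm v * euclid_norm (mat_adjoint A *\<^sub>v (A *\<^sub>v v))"
    by (rule cmod_cscalar_prod_le[OF v]) (use A' Av in simp)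
  finally show ?thesis
    by (simp add: normal_mat_norm_adjoint[OF A normal Av] mult.commute)
qed

text \<open>The recursion of \<open>^\<^sub>m\<close> puts the new factor on the right, where it
  acts first. Here it acts last, which gives consecutive terms of the orbit of
  \<open>v\<close>.\<close>

lemma mult_pow_mat_vec:
  fixes A :: "'a :: comm_semiring_1 mat"
  assumes A: "A \<in> carrier_mat n n" and v: "v \<in> carrier_vec n"
  shows "A *\<^sub>v (A ^\<^sub>m k *\<^sub>v v) = A ^\<^sub>m Suc k *\<^sub>v v"
  using v
proof (induction k arbitrary: v)
  case 0
  then show ?case using A by simp
next
  case (Suc k)
  have pow: "A ^\<^sub>m j \<in> carrier_mat n n" for j using A by simp
  have Suc_vec: "A ^\<^sub>m Suc j *\<^sub>v v = A ^\<^sub>m j *\<^sub>v (A *\<^sub>v v)" for j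
    using assoc_mult_mat_vec[OF pow A Suc.prems, of j] by simp
  show ?case
    unfolding Suc_vec using Suc.IH[of "A *\<^sub>v v"] Suc.prems A by simp
qed

text \<open>By \<open>normal_mat_norm_square_le\<close> the sequence \<open>\<parallel>A\<^sup>k v\<parallel>\<close> is log-convex, so the ratio of
  consecutive terms never falls below the first one.\<close>

lemma normal_mat_power_norm_ge:
  assumes A: "A \<in> carrier_mat n n" and normal: "normal_mat A" and v: "v \<in> carrier_vec n"
    and unit: "euclid_norm v = 1"
  shows "euclid_norm (A *\<^sub>v v) ^ k \<le> euclid_norm (A ^\<^sub>m k *\<^sub>v v)"
proof -
  define a where "a k = euclid_norm (A ^\<^sub>m k *\<^sub>v v)" for k
  have nonneg: "0 \<le> a k" for k unfolding a_def by simp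
  have a0: "a 0 = 1" and a1: "a 1 = euclid_norm (A *\<^sub>v v)"
    unfolding a_def using A v unit by simp_all
  have convex: "(a (Suc k))\<^sup>2 \<le> a (Suc (Suc k)) * a k" for k
  proof -
    have "A ^\<^sub>m k *\<^sub>v v \<in> carrier_vec n"
      by (rule mult_mat_vec_carrier[OF pow_carrier_mat[OF A] v])
    from normal_mat_norm_square_le[OF A normal this] show ?thesis
      unfolding a_def mult_pow_mat_vec[OF A v] .
  qed
  have ratio: "a 1 * a k \<le> a (Suc k)" for k
  proof (induction k)
    case 0
    then show ?case by (simp add: a0)
  next
    case (Suc k)
    show ?case
    proof (cases "a k = 0")
      \<comment> \<open>Nothing can be cancelled here, but log-convexity makes the next term vanish
        as well, so the left-hand side is 0.\<close>
      case True
      with convex[of k] have "a (Suc k) = 0" by simp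
      then show ?thesis using nonneg by simp
    next
      case False
      have "a 1 * a (Suc k) * a k = (a 1 * a k) * a (Suc k)" by simp
      also have "\<dots> \<le> (a (Suc k))\<^sup>2"
        unfolding power2_eq_square by (rule mult_right_mono[OF Suc nonneg])
      also have "\<dots> \<le> a (Suc (Suc k)) * a k" by (rule convex)
      finally show ?thesis using False nonneg[of k] by (simp add: mult_le_cancel_right)
    qed
  qed
  have "a 1 ^ k \<le> a k"
  proof (induction k)
    case 0
    then show ?case by (simp add: a0)
  next
    case (Suc k)
    have "a 1 ^ Suc k \<le> a 1 * a k" using Suc nonneg by (simp add: mult_left_mono)
    also have "\<dots> \<le> a (Suc k)" by (rule ratio)
    finally show ?case .
  qed
  then show ?thesis unfolding a1 by (simp add: a_def)
qed

section \<open>Contraction from a spectral radius below 1\<close>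

lemma euclid_norm_le_of_norm_bound:
  assumes B: "B \<in> carrier_mat n m" and v: "v \<in> carrier_vec m" and bound: "norm_bound B c"
  shows "euclid_norm (B *\<^sub>v v) \<le> (\<Sum>i<n. \<Sum>j<m. c * cmod (v $ j))"
proof -
  have "euclid_norm (B *\<^sub>v v) \<le> (\<Sum>i<n. cmod ((B *\<^sub>v v) $ i))"
    unfolding euclid_norm_def using B by (auto simp del: index_mult_mat_vec intro: L2_set_le_sum)
  also have "\<dots> \<le> (\<Sum>i<n. \<Sum>j<m. c * cmod (v $ j))"
    using B v bound unfolding norm_bound_def
    by (auto simp: scalar_prod_def atLeast0LessThan norm_mult
        simp del: sum_constant intro!: sum_mono order_trans[OF norm_sum] mult_right_mono)
  finally show ?thesis .
qed

lemma normal_mat_contraction: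
  assumes A: "A \<in> carrier_mat n n" and normal: "normal_mat A" and v: "v \<in> carrier_vec n"
    and unit: "euclid_norm v = 1" and radius: "spectral_radius A < 1"
  shows "euclid_norm (A *\<^sub>v v) \<le> 1"
proof (rule ccontr)
  assume gt: "\<not> euclid_norm (A *\<^sub>v v) \<le> 1"
  obtain c where c: "norm_bound (A ^\<^sub>m k) c" for k
    using spectral_radius_jnf_norm_bound_less_1_upper_triangular[OF A radius] by blast
  \<comment> \<open>The same \<open>c\<close> bounds the entries of every power, so the left-hand
    side is independent of \<open>k\<close>, while powers of a number above 1 are unbounded.\<close>
  obtain k where "(\<Sum>i<n. \<Sum>j<n. c * cmod (v $ j)) < euclid_norm (A *\<^sub>v v) ^ k"
    using gt real_arch_pow by (metis not_le)
  also have "\<dots> \<le> euclid_norm (A ^\<^sub>m k *\<^sub>v v)"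
    by (rule normal_mat_power_norm_ge[OF A normal v unit])
  also have "\<dots> \<le> (\<Sum>i<n. \<Sum>j<n. c * cmod (v $ j))"
    by (rule euclid_norm_le_of_norm_bound[OF pow_carrier_mat[OF A] v c])
  finally show False by simp
qed

section \<open>Scaling a shifted normal matrix to a contraction\<close>

lemma eigenvalue_smult_shift:
  fixes A :: "'a :: field mat"
  assumes A: "A \<in> carrier_mat n n" and c: "c \<noteq> 0"
    and e: "eigenvalue (c \<cdot>\<^sub>m (A + d \<cdot>\<^sub>m 1\<^sub>m n)) e"
  shows "eigenvalue A (e / c - d)"
proof -
  obtain v where v: "v \<in> carrier_vec n" "v \<noteq> 0\<^sub>v n"
    and ev: "(c \<cdot>\<^sub>m (A + d \<cdot>\<^sub>m 1\<^sub>m n)) *\<^sub>v v = e \<cdot>\<^sub>v v"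
    using e A unfolding eigenvalue_def eigenvector_def by auto
  have "(c \<cdot>\<^sub>m (A + d \<cdot>\<^sub>m 1\<^sub>m n)) *\<^sub>v v = c \<cdot>\<^sub>v (A *\<^sub>v v + d \<cdot>\<^sub>v v)"
    using A v by (simp add: smult_mult_mat_vec[of _ n n] add_mult_distrib_mat_vec[of _ n n])
  with ev have *: "c \<cdot>\<^sub>v (A *\<^sub>v v + d \<cdot>\<^sub>v v) = e \<cdot>\<^sub>v v" by simp
  have "A *\<^sub>v v = (e / c - d) \<cdot>\<^sub>v v"
  proof (rule eq_vecI)
    fix i assume i: "i < dim_vec ((e / c - d) \<cdot>\<^sub>v v)"
    then show "(A *\<^sub>v v) $ i = ((e / c - d) \<cdot>\<^sub>v v) $ i"
      using arg_cong[OF *, of "\<lambda>w. w $ i"] A v c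
      by (simp add: field_simps del: index_mult_mat_vec)
  qed (use A v in auto)
  with v A show ?thesis unfolding eigenvalue_def eigenvector_def by auto
qed

lemma normal_mat_shift_norm_le:
  assumes A: "A \<in> carrier_mat n n" and normal: "normal_mat A" and v: "v \<in> carrier_vec n"
    and unit: "euclid_norm v = 1"
    and bound: "\<And>l. l \<in> spectrum A \<Longrightarrow> cmod (l + d) \<le> M"
  shows "euclid_norm ((A + d \<cdot>\<^sub>m 1\<^sub>m n) *\<^sub>v v) \<le> M"
proof (rule dense_ge)
  \<comment> \<open>Dividing by \<open>r\<close> instead of \<open>M\<close> makes the spectral
    radius strictly less than 1 and avoids division by zero when \<open>M\<close> is 0.\<close>
  fix r assume r: "M < r"
  \<comment> \<open>The empty vector has norm 0, so a unit vector forces positive dimension and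
    hence an eigenvalue, which shows that \<open>M\<close> is nonnegative.\<close>
  have n: "n > 0" using unit v by (cases n) (auto simp: euclid_norm_def)
  obtain l where "l \<in> spectrum A" using spectrum_non_empty[OF A n] by blast
  with bound[of l] r have r0: "r > 0" using norm_ge_zero[of "l + d"] by linarith
  define c where "c = complex_of_real (1 / r)"
  define B where "B = A + d \<cdot>\<^sub>m 1\<^sub>m n"
  have B: "B \<in> carrier_mat n n" unfolding B_def using A by simp
  have cB: "c \<cdot>\<^sub>m B \<in> carrier_mat n n" using B by simp
  have "normal_mat (c \<cdot>\<^sub>m B)"
    unfolding B_def by (intro normal_mat_smult normal_mat_add_smult_one A normal)
  moreover have "spectral_radius (c \<cdot>\<^sub>m B) < 1"
  proof -
    obtain e where e: "eigenvalue (c \<cdot>\<^sub>m B) e" "spectral_radius (c \<cdot>\<^sub>m B) = cmod e"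
      using spectral_radius_mem_max(1)[OF cB n] by (auto simp: spectrum_def)
    \<comment> \<open>Solving e = c (l + d) for l returns to an eigenvalue of \<open>A\<close>,
      where \<open>bound\<close> applies to l + d = e / c.\<close>
    have "eigenvalue A (e / c - d)"
      using e(1) r0 unfolding B_def by (intro eigenvalue_smult_shift[OF A]) (auto simp: c_def)
    then have "cmod (e / c) \<le> M" using bound[of "e / c - d"] by (simp add: spectrum_def)
    then have "cmod e * r \<le> M" using r0 by (simp add: c_def norm_mult)
    then have "cmod e * r < 1 * r" using r by linarith
    then show ?thesis using e(2) r0 by simp
  qed
  ultimately have "euclid_norm ((c \<cdot>\<^sub>m B) *\<^sub>v v) \<le> 1"
    by (rule normal_mat_contraction[OF cB _ v unit])
  moreover have "(c \<cdot>\<^sub>m B) *\<^sub>v v = c \<cdot>\<^sub>v (B *\<^sub>v v)"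
    using B v by (simp add: smult_mult_mat_vec[of _ n n])
  ultimately show "euclid_norm ((A + d \<cdot>\<^sub>m 1\<^sub>m n) *\<^sub>v v) \<le> r"
    using r0 by (simp add: euclid_norm_smult c_def B_def norm_divide field_simps)
qed

section \<open>Trace, eigenvalues and spread\<close>

lemma mat_trace_mult_commute:
  fixes A :: "'a :: comm_semiring_0 mat"
  assumes "A \<in> carrier_mat n m" "B \<in> carrier_mat m n"
  shows "mat_trace (A * B) = mat_trace (B * A)"
proof -
  have "mat_trace (A * B) = (\<Sum>i<n. \<Sum>j<m. A $$ (i, j) * B $$ (j, i))"
    using assms by (simp add: mat_trace_def scalar_prod_def atLeast0LessThan)
  also have "\<dots> = (\<Sum>j<m. \<Sum>i<n. A $$ (i, j) * B $$ (j, i))" by (rule sum.swap)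
  also have "\<dots> = mat_trace (B * A)"
    using assms by (simp add: mat_trace_def scalar_prod_def atLeast0LessThan mult.commute)
  finally show ?thesis .
qed

text \<open>A Schur form of \<open>A\<close> is similar to \<open>A\<close> and carries
  \<open>es\<close> on its diagonal; cyclicity of the trace removes the similarity.\<close>

lemma mat_trace_eq_sum_list_roots:
  fixes A :: "'a :: conjugatable_ordered_field mat"
  assumes A: "A \<in> carrier_mat n n" and es: "char_poly A = (\<Prod>e\<leftarrow>es. [:- e, 1:])"
  shows "mat_trace A = sum_list es"
proof -
  obtain B P Q where schur: "schur_decomposition A es = (B, P, Q)"
    by (cases "schur_decomposition A es")
  have sim: "similar_mat_wit A B P Q" and diag: "diag_mat B = es"
    using schur_decomposition[OF A es schur] by auto
  note wit = similar_mat_witD2[OF A sim]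
  have "mat_trace A = mat_trace (P * (B * Q))" using wit by (simp add: assoc_mult_mat[of _ n n _ n _ n])
  also have "\<dots> = mat_trace (B * Q * P)"
    using wit by (intro mat_trace_mult_commute[of _ n n]) auto
  also have "B * Q * P = B" using wit by (simp add: assoc_mult_mat[of _ n n _ n _ n])
  also have "mat_trace B = sum_list (diag_mat B)"
    by (simp add: mat_trace_def diag_mat_def interv_sum_list_conv_sum_set_nat atLeast0LessThan)
  finally show ?thesis unfolding diag .
qed

lemma cmod_diff_le_spread:
  assumes A: "A \<in> carrier_mat n n" and x: "x \<in> spectrum A" and y: "y \<in> spectrum A"
  shows "cmod (x - y) \<le> spread A"
proof -
  have "{cmod (x - y) | x y. x \<in> spectrum A \<and> y \<in> spectrum A}
      = (\<lambda>(x, y). cmod (x - y)) ` (spectrum A \<times> spectrum A)" by auto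
  moreover have "finite (spectrum A)" by (rule card_finite_spectrum(1)[OF A])
  ultimately show ?thesis unfolding spread_def using x y by (auto intro!: Max_ge)
qed

lemma cmod_diff_mean_trace_le:
  assumes n: "n > 0" and A: "A \<in> carrier_mat n n" and l: "l \<in> spectrum A"
  shows "cmod (l - mat_trace A / of_nat n) \<le> (real n - 1) / real n * spread A"
proof -
  obtain es where es: "char_poly A = (\<Prod>e\<leftarrow>es. [:- e, 1:])" and len: "length es = n"
    using char_poly_factorized[OF A] by blast
  have "poly (\<Prod>e\<leftarrow>es. [:- e, 1:]) x = 0 \<longleftrightarrow> x \<in> set es" for x
    by (induction es) auto
  then have spec: "spectrum A = set es"
    unfolding spectrum_root_char_poly[OF A] es by auto
  with l len obtain k where k: "k < n" "l = es ! k" by (auto simp: in_set_conv_nth)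
  have "mat_trace A = (\<Sum>i<n. es ! i)"
    using mat_trace_eq_sum_list_roots[OF A es] len by (simp add: sum_list_sum_nth atLeast0LessThan)
  then have "of_nat n * (l - mat_trace A / of_nat n) = (\<Sum>i<n. l - es ! i)"
    using n by (simp add: sum_subtractf right_diff_distrib)
  \<comment> \<open>Only the index \<open>k\<close> is removed, not every occurrence of the value
    \<open>l\<close>, so exactly n - 1 summands remain even for a multiple eigenvalue.\<close>
  also have "\<dots> = (\<Sum>i\<in>{..<n} - {k}. l - es ! i)"
    using k by (simp add: sum.remove[of "{..<n}" k])
  finally have "real n * cmod (l - mat_trace A / of_nat n) = cmod (\<Sum>i\<in>{..<n} - {k}. l - es ! i)"
    by (metis norm_mult norm_of_nat)
  also have "\<dots> \<le> (\<Sum>i\<in>{..<n} - {k}. spread A)"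
    using len l by (intro sum_norm_le cmod_diff_le_spread[OF A]) (auto simp: spec)
  also have "\<dots> = (real n - 1) * spread A"
    using k by (simp add: of_nat_diff)
  finally show ?thesis using n by (simp add: field_simps)
qed

section \<open>Passing to the operator norm\<close>

lemma spectral_norm_le:
  assumes A: "A \<in> carrier_mat m n" and n: "n > 0"
    and bound: "\<And>v. v \<in> carrier_vec n \<Longrightarrow> euclid_norm v = 1 \<Longrightarrow> euclid_norm (A *\<^sub>v v) \<le> M"
  shows "spectral_norm A \<le> M"
proof -
  \<comment> \<open>Bounding a real supremum by \<open>cSup_least\<close> requires a nonempty set;
    the first standard basis vector supplies a member.\<close>
  have "euclid_norm (unit_vec n 0) = 1"
    using n by (simp add: euclid_norm_def L2_set_def unit_vec_def if_distrib[of "\<lambda>x. (cmod x)\<^sup>2"]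
        cong: if_cong)
  then have "\<exists>v. v \<in> carrier_vec n \<and> euclid_norm v = 1"
    using unit_vec_carrier by blast
  then show ?thesis
    unfolding spectral_norm_def using A by (intro cSup_least) (auto intro: bound)
qed

theorem theorem3p1:
  fixes A :: "complex mat" and n :: nat
  assumes "n \<ge> 2"
    and "A \<in> carrier_mat n n"
    and "normal_mat A"
  shows "spread A \<ge>
    real n / (real n - 1) * spectral_norm (A - (mat_trace A / of_nat n) \<cdot>\<^sub>m 1\<^sub>m n)"
proof -
  note A = assms(2)
  have n: "n > 0" using assms(1) by simp
  let ?t = "mat_trace A / of_nat n"
  have shift: "A - ?t \<cdot>\<^sub>m 1\<^sub>m n = A + (- ?t) \<cdot>\<^sub>m 1\<^sub>m n"
    using A by (intro eq_matI) auto
  have "spectral_norm (A - ?t \<cdot>\<^sub>m 1\<^sub>m n) \<le> (real n - 1) / real n * spread A"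
    unfolding shift using cmod_diff_mean_trace_le[OF n A]
    \<comment> \<open>The shift \<open>d\<close> is \<open>- ?t\<close>, and \<open>M\<close> is the
      bound on the distance of any eigenvalue from the mean \<open>?t\<close>.\<close>
    by (intro spectral_norm_le[of _ n n] normal_mat_shift_norm_le[OF A assms(3)])
      (use A n in auto)
  then show ?thesis using assms(1) by (simp add: field_simps)
qed

end
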